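(* Let $X$ be a Banach space, let $T\in B(X)$, and assume that there exists a dense set $X_0\subset X$ such that $T^nx\to0$ as $n\to\infty$ for all $x\in X_0$. Then the following assertions are equivalent: (i) $T$ is distributionally chaotic of type $1$; (ii) $T$ is distributionally chaotic of type $2$; (iii) $T$ is distributionally chaotic of type $2\frac12$; (iv) $T$ is reiteratively distributionally chaotic of type $2$.
   Context: $B(X)$ is the space of bounded linear operators $X\to X$. For $A\subset\mathbb N$: $\underline{\mathrm{dens}}(A)=\liminf_{n\to\infty}\frac{\mathrm{card}(A\cap[1,n])}{n}$, $\overline{\mathrm{dens}}(A)=\limsup_{n\to\infty}\frac{\mathrm{card}(A\cap[1,n])}{n}$, $\overline{\mathrm{Bd}}(A)=\lim_{n\to\infty}\limsup_{m\to\infty}\frac{\mathrm{card}(A\cap[m+1,m+n])}{n}$. For $x,y\in X$ and $\delta>0$ put $D_{x,y}(\delta)=\{j\in\mathbb N:\|T^jx-T^jy\|<\delta\}$ and $F_{x,y}(\delta)=\underline{\mathrm{dens}}(D_{x,y}(\delta))$, $F^*_{x,y}(\delta)=\overline{\mathrm{dens}}(D_{x,y}(\delta))$, $BF^*_{x,y}(\delta)=\overline{\mathrm{Bd}}(D_{x,y}(\delta))$. Writing "$\equiv1$" means equality to $1$ for all $\delta>0$. A pair $(x,y)$ is a distributionally chaotic pair for $T$ of type $1$ if $F^*_{x,y}\equiv1$ and $F_{x,y}(\varepsilon)=0$ for some $\varepsilon>0$; of type $2$ if $F^*_{x,y}\equiv1$ and $F_{x,y}(\varepsilon)<1$ for some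 $\varepsilon>0$; of type $2\frac12$ if there exist $c>0$ and $r>0$ with $F_{x,y}(\delta)<c<F^*_{x,y}(\delta)$ for all $0<\delta<r$. For $k\in\{1,2,2\frac12\}$, $T$ is distributionally chaotic of type $k$ if there is an uncountable set $\Gamma\subset X$ such that every pair of distinct points of $\Gamma$ is a distributionally chaotic pair of type $k$ for $T$. $T$ is reiteratively distributionally chaotic of type $2$ if there exist an uncountable $\Gamma\subset X$ and $\varepsilon>0$ such that for all distinct $x,y\in\Gamma$, $BF^*_{x,y}\equiv1$ and $F_{x,y}(\varepsilon)<1$. *)

theory Defs
  imports "HOL-Analysis.Analysis"
begin

text \<open>Densities are taken in \<^typ>\<open>ereal\<close>, a complete lattice, so that the limits inferior and superior
  are the library ones; all values lie in the interval from 0 to 1. The term of index \<open>n = 0\<close> is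
  \<open>0 / 0 = 0\<close> and does not affect the limits.\<close>

definition lower_density :: "nat set \<Rightarrow> ereal" where
  "lower_density A = liminf (\<lambda>n. ereal (real (card (A \<inter> {1..n})) / real n))"

definition upper_density :: "nat set \<Rightarrow> ereal" where
  "upper_density A = limsup (\<lambda>n. ereal (real (card (A \<inter> {1..n})) / real n))"

text \<open>The outer limit exists for every \<open>A\<close>: the numbers
  \<open>limsup (\<lambda>m. card (A \<inter> {m+1..m+n}))\<close> are subadditive in \<open>n\<close>, so Fekete's lemma applies.\<close>

definition upper_Banach_density :: "nat set \<Rightarrow> ereal" where
  "upper_Banach_density A =
     lim (\<lambda>n. limsup (\<lambda>m. ereal (real (card (A \<inter> {m+1..m+n})) / real n)))"

text \<open>Index 0 is admitted in the following set; all three densities ignore it.\<close>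

definition close_times :: "('a::real_normed_vector \<Rightarrow> 'a) \<Rightarrow> 'a \<Rightarrow> 'a \<Rightarrow> real \<Rightarrow> nat set" where
  "close_times T x y \<delta> = {j. norm ((T ^^ j) x - (T ^^ j) y) < \<delta>}"

definition F_lower :: "('a::real_normed_vector \<Rightarrow> 'a) \<Rightarrow> 'a \<Rightarrow> 'a \<Rightarrow> real \<Rightarrow> ereal" where
  "F_lower T x y \<delta> = lower_density (close_times T x y \<delta>)"

definition F_upper :: "('a::real_normed_vector \<Rightarrow> 'a) \<Rightarrow> 'a \<Rightarrow> 'a \<Rightarrow> real \<Rightarrow> ereal" where
  "F_upper T x y \<delta> = upper_density (close_times T x y \<delta>)"

definition BF_upper :: "('a::real_normed_vector \<Rightarrow> 'a) \<Rightarrow> 'a \<Rightarrow> 'a \<Rightarrow> real \<Rightarrow> ereal" where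
  "BF_upper T x y \<delta> = upper_Banach_density (close_times T x y \<delta>)"

definition dist_chaotic_pair_1 :: "('a::real_normed_vector \<Rightarrow> 'a) \<Rightarrow> 'a \<Rightarrow> 'a \<Rightarrow> bool" where
  "dist_chaotic_pair_1 T x y \<longleftrightarrow>
     (\<forall>\<delta>>0. F_upper T x y \<delta> = 1) \<and> (\<exists>\<epsilon>>0. F_lower T x y \<epsilon> = 0)"

definition dist_chaotic_pair_2 :: "('a::real_normed_vector \<Rightarrow> 'a) \<Rightarrow> 'a \<Rightarrow> 'a \<Rightarrow> bool" where
  "dist_chaotic_pair_2 T x y \<longleftrightarrow>
     (\<forall>\<delta>>0. F_upper T x y \<delta> = 1) \<and> (\<exists>\<epsilon>>0. F_lower T x y \<epsilon> < 1)"

definition dist_chaotic_pair_2_half :: "('a::real_normed_vector \<Rightarrow> 'a) \<Rightarrow> 'a \<Rightarrow> 'a \<Rightarrow> bool" where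
  "dist_chaotic_pair_2_half T x y \<longleftrightarrow>
     (\<exists>c::real. \<exists>r::real. c > 0 \<and> r > 0 \<and>
        (\<forall>\<delta>. 0 < \<delta> \<and> \<delta> < r \<longrightarrow> F_lower T x y \<delta> < ereal c \<and> ereal c < F_upper T x y \<delta>))"

definition dist_chaotic_1 :: "('a::real_normed_vector \<Rightarrow> 'a) \<Rightarrow> bool" where
  "dist_chaotic_1 T \<longleftrightarrow> (\<exists>\<Gamma>. uncountable \<Gamma> \<and> pairwise (dist_chaotic_pair_1 T) \<Gamma>)"

definition dist_chaotic_2 :: "('a::real_normed_vector \<Rightarrow> 'a) \<Rightarrow> bool" where
  "dist_chaotic_2 T \<longleftrightarrow> (\<exists>\<Gamma>. uncountable \<Gamma> \<and> pairwise (dist_chaotic_pair_2 T) \<Gamma>)"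

definition dist_chaotic_2_half :: "('a::real_normed_vector \<Rightarrow> 'a) \<Rightarrow> bool" where
  "dist_chaotic_2_half T \<longleftrightarrow> (\<exists>\<Gamma>. uncountable \<Gamma> \<and> pairwise (dist_chaotic_pair_2_half T) \<Gamma>)"

text \<open>Unlike in the preceding notions, \<open>\<epsilon>\<close> is uniform over all pairs of points of \<open>\<Gamma>\<close>.\<close>

definition reiteratively_dist_chaotic_2 :: "('a::real_normed_vector \<Rightarrow> 'a) \<Rightarrow> bool" where
  "reiteratively_dist_chaotic_2 T \<longleftrightarrow>
     (\<exists>\<Gamma>. \<exists>\<epsilon>>0. uncountable \<Gamma> \<and>
        pairwise (\<lambda>x y. (\<forall>\<delta>>0. BF_upper T x y \<delta> = 1) \<and> F_lower T x y \<epsilon> < 1) \<Gamma>)"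

end

theory Submission
  imports Defs
begin

text \<open>
  Call growth by a factor \<open>R\<close> rare if, for some \<open>\<theta> < 1\<close>, every orbit segment of length \<open>N\<close> starting
  at \<open>y\<close> exceeds \<open>R * norm y\<close> at no more than \<open>\<theta> * N\<close> times. Restarting the orbit at the beginning of each
  excursion above \<open>R * norm y\<close> shows that growth by the factor \<open>R ^ k\<close> then has frequency at most
  \<open>\<theta> ^ k\<close>. Hence an orbit that comes arbitrarily close to \<open>0\<close> stays close to \<open>0\<close> along a set of density
  \<open>1\<close>, which each of the four notions of chaos forbids for the difference of a chaotic pair.
  So for all \<open>R\<close> and \<open>\<theta>\<close> some vector grows by the factor \<open>R\<close> with frequency above \<open>\<theta>\<close>. Adding small
  multiples of such vectors to points of \<open>X0\<close>, Baire's theorem yields a vector \<open>u\<close> whose orbit is near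
  \<open>0\<close>, and also near infinity, with upper density \<open>1\<close>; the line spanned by \<open>u\<close> is then the required
  uncountable set for all four notions.
\<close>

section \<open>Densities\<close>

lemma frequently_le_Limsup:
  fixes f :: "'b \<Rightarrow> 'c::complete_linorder"
  assumes "\<exists>\<^sub>F n in F. C \<le> f n"
  shows "C \<le> Limsup F f"
proof (rule ccontr)
  assume "\<not> C \<le> Limsup F f"
  then have "\<forall>\<^sub>F n in F. f n < C" by (intro Limsup_lessD) simp
  with assms show False by (simp add: frequently_def not_le)
qed

lemma frequently_ge_Liminf:
  fixes f :: "'b \<Rightarrow> 'c::complete_linorder"
  assumes "\<exists>\<^sub>F n in F. f n \<le> C"
  shows "Liminf F f \<le> C"
proof (rule ccontr)
  assume "\<not> Liminf F f \<le> C"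
  then have "\<forall>\<^sub>F n in F. C < f n" by (intro less_LiminfD) simp
  with assms show False by (simp add: frequently_def not_le)
qed

lemma card_Int_atLeastAtMost_le: "card (A \<inter> {1..n::nat}) \<le> n"
  using card_mono[of "{1..n}" "A \<inter> {1..n}"] by simp

lemma density_quotient_le_1: "real (card (A \<inter> {1..n})) / real n \<le> 1"
  using card_Int_atLeastAtMost_le[of A n] by (cases "n = 0") (simp_all add: divide_le_eq)

lemma upper_density_le_1: "upper_density A \<le> 1"
  unfolding upper_density_def
  by (rule Limsup_bounded) (use density_quotient_le_1 in simp)

lemma lower_density_nonneg: "0 \<le> lower_density A"
  unfolding lower_density_def by (rule Liminf_bounded) simp

lemma upper_density_pos_imp_nonempty:
  assumes "0 < upper_density A" shows "A \<noteq> {}"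
  using assms by (auto simp: upper_density_def zero_ereal_def[symmetric] Limsup_const)

lemma upper_density_eq_1I:
  assumes "\<And>e. e > 0 \<Longrightarrow> \<exists>\<^sub>F n in sequentially. (1 - e) * real n \<le> real (card (A \<inter> {1..n}))"
  shows "upper_density A = 1"
proof (rule antisym[OF upper_density_le_1])
  have "ereal (1 - e) \<le> upper_density A" if "e > 0" for e
    unfolding upper_density_def
  proof (rule frequently_le_Limsup, rule frequently_rev_mp[OF assms[OF that]])
    show "\<forall>\<^sub>F n in sequentially. (1 - e) * real n \<le> real (card (A \<inter> {1..n})) \<longrightarrow>
        ereal (1 - e) \<le> ereal (real (card (A \<inter> {1..n})) / real n)"
      using eventually_gt_at_top[of 0] by eventually_elim (simp add: le_divide_eq)
  qed
  then have "1 - ereal e \<le> upper_density A" if "e > 0" for e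
    using that by (simp add: one_ereal_def)
  then show "1 \<le> upper_density A"
    by (metis ereal_le_epsilon2 ereal_minus_le add.commute ereal.distinct(1) abs_ereal.simps(1) MInfty_neq_ereal(1) PInfty_neq_ereal(1))
qed

lemma upper_density_eq_1D:
  assumes "upper_density A = 1" "e > 0"
  shows "\<exists>\<^sub>F n in sequentially. (1 - e) * real n \<le> real (card (A \<inter> {1..n}))"
proof (rule ccontr)
  assume "\<not> ?thesis"
  then have sparse: "\<forall>\<^sub>F n in sequentially. real (card (A \<inter> {1..n})) < (1 - e) * real n"
    by (simp add: not_frequently not_le)
  have "upper_density A \<le> ereal (1 - e)"
    unfolding upper_density_def
  proof (intro Limsup_bounded, use sparse eventually_gt_at_top[of 0] in eventually_elim)
    case (elim n)
    then show ?case by (simp add: divide_le_eq)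
  qed
  then show False using assms by (simp add: one_ereal_def)
qed

text \<open>Whenever \<open>A\<close> fills all but a fraction \<open>e\<close> of
  \<open>{1..n}\<close>, at most \<open>e * n\<close> points of \<open>{1..n}\<close> remain for
  \<open>B\<close>; this happens for arbitrarily large \<open>n\<close>.\<close>

lemma lower_density_eq_0_if_disjoint:
  assumes "upper_density A = 1" "A \<inter> B = {}"
  shows "lower_density B = 0"
proof (rule antisym[OF _ lower_density_nonneg], rule ereal_le_epsilon2)
  fix e :: real assume e: "e > 0"
  have "card (A \<inter> {1..n}) + card (B \<inter> {1..n}) \<le> n" for n
    using card_Un_disjoint[of "A \<inter> {1..n}" "B \<inter> {1..n}"] assms(2)
      card_Int_atLeastAtMost_le[of "A \<union> B" n] by (simp add: Int_Un_distrib2 disjoint_iff)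
  then have *: "real (card (A \<inter> {1..n})) + real (card (B \<inter> {1..n})) \<le> real n" for n
    by (metis of_nat_add of_nat_le_iff)
  have "lower_density B \<le> ereal e"
    unfolding lower_density_def
  proof (rule frequently_ge_Liminf, rule frequently_rev_mp[OF upper_density_eq_1D[OF assms(1) e]])
    show "\<forall>\<^sub>F n in sequentially. (1 - e) * real n \<le> real (card (A \<inter> {1..n})) \<longrightarrow>
        ereal (real (card (B \<inter> {1..n})) / real n) \<le> ereal e"
      using eventually_gt_at_top[of 0]
    proof eventually_elim
      case (elim n)
      then show ?case using *[of n] by (auto simp: divide_le_eq algebra_simps)
    qed
  qed
  then show "lower_density B \<le> 0 + ereal e" by simp
qed

text \<open>If from \<open>M\<close> on every window of length \<open>n\<close> missed a point of
  \<open>A\<close>, then cutting the half-line beyond \<open>M\<close> into such windows would bound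
  the upper density by 1 - 1/n.\<close>

lemma upper_density_1_imp_long_intervals:
  assumes "upper_density A = 1" "n > 0"
  shows "\<exists>\<^sub>F m in sequentially. {m+1..m+n} \<subseteq> A"
proof (rule ccontr)
  assume "\<not> ?thesis"
  then obtain M where M: "\<And>m. m \<ge> M \<Longrightarrow> \<not> {m+1..m+n} \<subseteq> A"
    by (auto simp: not_frequently eventually_sequentially)
  have blocks: "card (A \<inter> {1..M+q*n}) \<le> M + q * (n-1)" for q
  proof (induction q)
    case 0 then show ?case using card_Int_atLeastAtMost_le[of A M] by simp
  next
    case (Suc q)
    define m where "m = M + q*n"
    obtain x where x: "x \<in> {m+1..m+n}" "x \<notin> A" using M[of m] unfolding m_def by (meson le_add1 subsetI)
    have "card (A \<inter> {m+1..m+n}) \<le> card ({m+1..m+n} - {x})"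
      by (rule card_mono) (use x in auto)
    also have "\<dots> = n - 1" using x by (simp add: card_Diff_subset)
    finally have 1: "card (A \<inter> {m+1..m+n}) \<le> n - 1" .
    have "A \<inter> {1..M+Suc q*n} = A \<inter> {1..m} \<union> A \<inter> {m+1..m+n}" by (auto simp: m_def)
    then have "card (A \<inter> {1..M+Suc q*n}) \<le> card (A \<inter> {1..m}) + card (A \<inter> {m+1..m+n})"
      by (metis card_Un_le)
    then show ?case using 1 Suc by (simp add: m_def)
  qed
  \<comment> \<open>Rounding \<open>N - M\<close> down to a multiple of \<open>n\<close> leaves
    fewer than \<open>n\<close> points uncounted.\<close>
  have bound: "real (card (A \<inter> {1..N})) \<le> real M + real n + (1 - 1/real n) * real N" if "N \<ge> M" for N
  proof -
    define q where "q = (N - M) div n"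
    have q: "q * n \<le> N - M" "N - M < q * n + n"
      using assms(2) dividend_less_div_times[of n "N - M"] unfolding q_def
      by (simp_all add: div_times_less_eq_dividend add.commute)
    have "A \<inter> {1..N} \<subseteq> A \<inter> {1..M+q*n} \<union> {M+q*n+1..M+q*n+n}" using q that by auto
    then have "card (A \<inter> {1..N}) \<le> card (A \<inter> {1..M+q*n} \<union> {M+q*n+1..M+q*n+n})"
      by (intro card_mono) auto
    also have "\<dots> \<le> card (A \<inter> {1..M+q*n}) + n"
      using card_Un_le[of "A \<inter> {1..M+q*n}" "{M+q*n+1..M+q*n+n}"] by simp
    also have "\<dots> \<le> M + n + q * (n-1)" using blocks[of q] by simp
    finally have "real (card (A \<inter> {1..N})) \<le> real (M + n + q * (n-1))" by (simp only: of_nat_le_iff)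
    also have "\<dots> = real M + real n + (1 - 1/real n) * (real q * real n)"
      using assms(2) by (simp add: of_nat_diff field_simps)
    also have "\<dots> \<le> real M + real n + (1 - 1/real n) * real N"
    proof -
      have "real q * real n \<le> real N"
        using q(1) by (metis of_nat_mult of_nat_le_iff diff_le_self order_trans)
      then show ?thesis using assms(2) by (intro add_left_mono mult_left_mono) auto
    qed
    finally show ?thesis .
  qed
  \<comment> \<open>The density 1 - 1/(2n) lies strictly between 1 - 1/n and 1, and the gap N/(2n)
    eventually exceeds the constant \<open>M + n\<close>.\<close>
  have "\<exists>\<^sub>F N in sequentially. (1 - 1/(2*real n)) * real N \<le> real (card (A \<inter> {1..N}))"
    using assms by (intro upper_density_eq_1D) auto
  moreover have "\<forall>\<^sub>F N in sequentially. \<not> (1 - 1/(2*real n)) * real N \<le> real (card (A \<inter> {1..N}))"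
    using eventually_ge_at_top[of M] eventually_gt_at_top[of "2*n*(M+n)"]
  proof eventually_elim
    case (elim N)
    have "2 * real n * (real M + real n) < real N"
      using elim(2) by (metis of_nat_add of_nat_less_iff of_nat_mult of_nat_numeral)
    then have "real M + real n < real N / (2*real n)"
      using assms(2) by (simp add: field_simps)
    also have "\<dots> = real N / real n - real N / (2*real n)" by (simp add: field_simps)
    finally show ?case using bound[OF elim(1)] by (simp add: algebra_simps)
  qed
  ultimately show False by (simp add: frequently_def)
qed

text \<open>Windows of each length \<open>n > 0\<close> lie inside \<open>A\<close> arbitrarily far
  out, so the inner limsup is already 1 and the outer limit is that of an eventually constant
  sequence.\<close>

lemma upper_Banach_density_eq_1_if_upper_density_eq_1:
  assumes "upper_density A = 1"
  shows "upper_Banach_density A = 1"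
proof -
  have "limsup (\<lambda>m. ereal (real (card (A \<inter> {m+1..m+n})) / real n)) = 1" if n: "n > 0" for n
  proof (rule antisym)
    have "card (A \<inter> {m+1..m+n}) \<le> n" for m
      using card_mono[of "{m+1..m+n}" "A \<inter> {m+1..m+n}"] by simp
    then show "limsup (\<lambda>m. ereal (real (card (A \<inter> {m+1..m+n})) / real n)) \<le> 1"
      using n by (intro Limsup_bounded always_eventually) (simp add: divide_le_eq)
    show "1 \<le> limsup (\<lambda>m. ereal (real (card (A \<inter> {m+1..m+n})) / real n))"
    proof (rule frequently_le_Limsup,
        rule frequently_elim1[OF upper_density_1_imp_long_intervals[OF assms n]])
      fix m assume "{m+1..m+n} \<subseteq> A"
      then have "A \<inter> {m+1..m+n} = {m+1..m+n}" by blast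
      then show "1 \<le> ereal (real (card (A \<inter> {m+1..m+n})) / real n)" using n by simp
    qed
  qed
  then have "(\<lambda>n. limsup (\<lambda>m. ereal (real (card (A \<inter> {m+1..m+n})) / real n))) \<longlonglongrightarrow> 1"
    by (intro tendsto_eventually eventually_mono[OF eventually_gt_at_top[of 0]])
  then show ?thesis unfolding upper_Banach_density_def by (rule limI)
qed

lemma upper_Banach_density_empty: "upper_Banach_density {} = 0"
  unfolding upper_Banach_density_def
  by (rule limI) (simp add: zero_ereal_def[symmetric] Limsup_const)

section \<open>Growth along orbits\<close>

text \<open>The bound is uniform in \<open>y\<close> and holds for every finite \<open>N\<close>, so
  it applies to each run of an orbit separately; its failure provides one vector and one finite
  window.\<close>

definition rarely_grows :: "('a::real_normed_vector \<Rightarrow> 'a) \<Rightarrow> real \<Rightarrow> real \<Rightarrow> bool" where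
  "rarely_grows T R \<theta> \<longleftrightarrow>
     (\<forall>y N. real (card ({j. R * norm y < norm ((T ^^ j) y)} \<inter> {1..N})) \<le> \<theta> * real N)"

text \<open>The points of \<open>B\<close> up to \<open>N\<close> split into maximal runs, each preceded by a point outside \<open>B\<close>.\<close>

lemma card_le_by_runs:
  fixes B C :: "nat set"
  assumes "0 \<notin> B" "C \<subseteq> B"
    and sparse: "\<And>a n. a \<notin> B \<Longrightarrow> real (card (C \<inter> {a+1..a+n})) \<le> \<theta> * real n"
  shows "real (card (C \<inter> {1..N})) \<le> \<theta> * real (card (B \<inter> {1..N}))"
proof (induction N rule: less_induct)
  case (less N)
  show ?case
  proof (cases "N \<in> B")
    case False
    then have "N \<notin> C" using assms by blast
    show ?thesis
    proof (cases N)
      case (Suc M)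
      have "B \<inter> {1..N} = B \<inter> {1..M}" "C \<inter> {1..N} = C \<inter> {1..M}"
        using False \<open>N \<notin> C\<close> Suc by (auto simp: le_Suc_eq)
      then show ?thesis using less.IH[of M] Suc by simp
    qed simp
  next
    case True
    \<comment> \<open>The last run inside \<open>B\<close> is \<open>{a+1..N}\<close>:
      \<open>sparse\<close> applies to it and the induction hypothesis to \<open>{1..a}\<close>.
      Such an \<open>a\<close> exists because 0 is outside \<open>B\<close>.\<close>
    define a where "a = Max {a. a < N \<and> a \<notin> B}"
    have "N > 0" using True assms by (cases N) auto
    then have "{a. a < N \<and> a \<notin> B} \<noteq> {}" using assms by blast
    then have "a \<in> {a. a < N \<and> a \<notin> B}" unfolding a_def by (intro Max_in) auto
    then have a: "a < N" "a \<notin> B" by auto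
    have "j \<in> B" if "a < j" "j \<le> N" for j
    proof (rule ccontr)
      assume "j \<notin> B"
      with that True have "j \<in> {a. a < N \<and> a \<notin> B}" by (cases "j = N") auto
      then have "j \<le> a" unfolding a_def by (intro Max_ge) auto
      with that show False by simp
    qed
    then have B: "B \<inter> {1..N} = B \<inter> {1..a} \<union> {a+1..a+(N-a)}" using a by auto
    have C: "C \<inter> {1..N} = C \<inter> {1..a} \<union> C \<inter> {a+1..a+(N-a)}" using a by auto
    have "card (C \<inter> {1..N}) = card (C \<inter> {1..a}) + card (C \<inter> {a+1..a+(N-a)})"
      unfolding C by (rule card_Un_disjoint) auto
    moreover have "card (B \<inter> {1..N}) = card (B \<inter> {1..a}) + (N - a)"
      unfolding B by (subst card_Un_disjoint) auto
    ultimately show ?thesis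
      using less.IH[OF a(1)] sparse[OF a(2), of "N-a"] by (simp add: distrib_left)
  qed
qed

lemma rarely_grows_mult:
  assumes "rarely_grows T R \<theta>" "rarely_grows T R' \<theta>'" "R \<ge> 1" "R' \<ge> 1" "\<theta>' \<ge> 0"
  shows "rarely_grows T (R' * R) (\<theta>' * \<theta>)"
  unfolding rarely_grows_def
proof (intro allI)
  fix y N
  define B where "B = {j. R * norm y < norm ((T ^^ j) y)}"
  define C where "C = {j. R' * R * norm y < norm ((T ^^ j) y)}"
  \<comment> \<open>\<open>R \<ge> 1\<close> keeps time 0 out of \<open>B\<close>, so that every run
    in \<open>B\<close> has a predecessor outside; \<open>R' \<ge> 1\<close> puts \<open>C\<close>
    inside \<open>B\<close>.\<close>
  have "norm y \<le> R * norm y" "R * norm y \<le> R' * (R * norm y)"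
    using assms by (auto intro!: mult_left_mono simp: mult_le_cancel_right1 mult_less_0_iff)
  then have "0 \<notin> B" "C \<subseteq> B" by (auto simp: B_def C_def mult.assoc)
  moreover have "real (card (C \<inter> {a+1..a+n})) \<le> \<theta>' * real n" if "a \<notin> B" for a n
  proof -
    define z where "z = (T ^^ a) y"
    have "R' * norm z \<le> R' * (R * norm y)"
      using that assms(4) by (intro mult_left_mono) (auto simp: B_def z_def)
    \<comment> \<open>Outside \<open>B\<close> the vector \<open>z\<close> has norm at most
      \<open>R * norm y\<close>, so a later time in \<open>C\<close> is, counted from
      \<open>a\<close>, a time at which \<open>z\<close> has grown by \<open>R'\<close>.\<close>
    then have "(\<lambda>j. j - a) ` (C \<inter> {a+1..a+n}) \<subseteq> {i. R' * norm z < norm ((T ^^ i) z)} \<inter> {1..n}"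
      by (auto simp: C_def z_def mult.assoc simp flip: funpow_add[THEN fun_cong, unfolded o_apply])
    then have "card ((\<lambda>j. j - a) ` (C \<inter> {a+1..a+n}))
        \<le> card ({i. R' * norm z < norm ((T ^^ i) z)} \<inter> {1..n})"
      by (intro card_mono) auto
    moreover have "inj_on (\<lambda>j. j - a) (C \<inter> {a+1..a+n})" by (auto simp: inj_on_def)
    ultimately show ?thesis
      using assms(2)[unfolded rarely_grows_def, rule_format, of z n] by (simp add: card_image)
  qed
  ultimately have "real (card (C \<inter> {1..N})) \<le> \<theta>' * real (card (B \<inter> {1..N}))"
    by (rule card_le_by_runs)
  also have "\<dots> \<le> \<theta>' * (\<theta> * real N)"
    using assms(1,5) unfolding rarely_grows_def B_def by (intro mult_left_mono) auto
  finally show "real (card ({j. R' * R * norm y < norm ((T ^^ j) y)} \<inter> {1..N})) \<le> \<theta>' * \<theta> * real N"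
    by (simp add: C_def mult.assoc)
qed

lemma rarely_grows_power:
  assumes "rarely_grows T R \<theta>" "R \<ge> 1" "\<theta> \<ge> 0"
  shows "rarely_grows T (R ^ Suc k) (\<theta> ^ Suc k)"
proof (induction k)
  case (Suc k)
  then show ?case
    using rarely_grows_mult[of T "R ^ Suc k" "\<theta> ^ Suc k" R \<theta>] assms
      one_le_power[of R "Suc k"] by simp
qed (use assms in simp)

text \<open>After the orbit drops below \<epsilon> / K at time \<open>m\<close>, it can reach
  \<epsilon> again only by growing by more than the factor \<open>K\<close>, which takes up at most
  the fraction \<eta> of each initial window.\<close>

lemma rarely_grows_imp_lower_density_ge:
  assumes "rarely_grows T K \<eta>" "K > 0" "\<eta> \<ge> 0" "norm ((T ^^ m) z) < \<epsilon> / K"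
  shows "ereal (1 - \<eta>) \<le> lower_density {j. norm ((T ^^ j) z) < \<epsilon>}"
proof -
  define A where "A = {j. norm ((T ^^ j) z) < \<epsilon>}"
  define w where "w = (T ^^ m) z"
  define D where "D = {j. K * norm w < norm ((T ^^ j) w)}"
  have w: "K * norm w < \<epsilon>" using assms(2,4) by (simp add: w_def less_divide_eq mult.commute)
  have bound: "(1 - \<eta>) * real n \<le> real m + real (card (A \<inter> {1..n}))" for n
  proof -
    \<comment> \<open>A time up to \<open>n\<close> is close, or belongs to the first
      \<open>m\<close>, or is a growth time of \<open>w\<close> shifted by \<open>m\<close>.\<close>
    have "{1..n} \<subseteq> A \<inter> {1..n} \<union> {1..m} \<union> (\<lambda>j. m + j) ` (D \<inter> {1..n})"
    proof
      fix j assume j: "j \<in> {1..n}"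
      show "j \<in> A \<inter> {1..n} \<union> {1..m} \<union> (\<lambda>j. m + j) ` (D \<inter> {1..n})"
      proof (cases "j \<in> A \<or> j \<le> m")
        case False
        have "(T ^^ (j-m)) w = (T ^^ j) z"
          using False unfolding w_def
          by (metis comp_apply funpow_add le_add_diff_inverse2 nle_le)
        then have "j - m \<in> D" using False w by (auto simp: D_def A_def)
        moreover have "j - m \<in> {1..n}" using False j by auto
        moreover have "j = m + (j - m)" using False by simp
        ultimately show ?thesis by blast
      qed (use j in auto)
    qed
    then have "n \<le> card (A \<inter> {1..n} \<union> {1..m} \<union> (\<lambda>j. m + j) ` (D \<inter> {1..n}))"
      using card_mono[of "A \<inter> {1..n} \<union> {1..m} \<union> (\<lambda>j. m + j) ` (D \<inter> {1..n})" "{1..n}"] by simp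
    also have "\<dots> \<le> card (A \<inter> {1..n}) + m + card (D \<inter> {1..n})"
      by (intro order_trans[OF card_Un_le] add_mono card_image_le) (use card_Un_le[of "A \<inter> {1..n}" "{1..m}"] in auto)
    finally have "real n \<le> real (card (A \<inter> {1..n})) + real m + real (card (D \<inter> {1..n}))"
      by (metis of_nat_add of_nat_le_iff)
    moreover have "real (card (D \<inter> {1..n})) \<le> \<eta> * real n"
      using assms(1) unfolding rarely_grows_def D_def by blast
    ultimately show ?thesis by (simp add: algebra_simps)
  qed
  \<comment> \<open>The first \<open>m\<close> times cost only \<open>m / n\<close>, which vanishes
    in the limit.\<close>
  have "ereal (1 - \<eta>) = liminf (\<lambda>n. ereal (1 - \<eta> - real m / real n))"
  proof (rule lim_imp_Liminf[symmetric])
    have "(\<lambda>n. 1 - \<eta> - real m / real n) \<longlonglongrightarrow> 1 - \<eta> - 0"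
      by (intro tendsto_diff tendsto_const lim_const_over_n)
    then show "(\<lambda>n. ereal (1 - \<eta> - real m / real n)) \<longlonglongrightarrow> ereal (1 - \<eta>)" by simp
  qed simp
  also have "\<dots> \<le> lower_density A"
    unfolding lower_density_def
  proof (rule Liminf_mono, use eventually_gt_at_top[of 0] in eventually_elim)
    case (elim n)
    then have "(1 - \<eta> - real m / real n) * real n = (1 - \<eta>) * real n - real m"
      by (simp add: left_diff_distrib)
    then show ?case using bound[of n] elim by (simp add: le_divide_eq)
  qed
  finally show ?thesis by (simp add: A_def)
qed

text \<open>The orbit of \<open>z\<close> drops below \<epsilon> / \<open>R ^ Suc k\<close> for
  every \<open>k\<close>. Were growth rare, its lower density of times below \<epsilon> would be at
  least 1 - \<theta>\<open>^ Suc k\<close> for all \<open>k\<close>, hence 1.\<close>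

lemma not_rarely_grows:
  assumes small: "\<And>\<delta>. \<delta> > 0 \<Longrightarrow> \<exists>m. norm ((T ^^ m) z) < \<delta>"
    and "\<epsilon> > 0" "lower_density {j. norm ((T ^^ j) z) < \<epsilon>} < 1"
    and "R \<ge> 1" "0 \<le> \<theta>" "\<theta> < 1"
  shows "\<not> rarely_grows T R \<theta>"
proof
  assume S: "rarely_grows T R \<theta>"
  have "1 \<le> lower_density {j. norm ((T ^^ j) z) < \<epsilon>}"
  proof (rule ereal_le_epsilon2)
    fix e :: real assume "e > 0"
    then obtain k where "\<theta> ^ k < e" using assms real_arch_pow_inv by blast
    then have k: "\<theta> ^ Suc k < e"
      using assms power_decreasing[of k "Suc k" \<theta>] by (meson le_less_trans less_imp_le lessI)
    have R: "R ^ Suc k > 0" using assms by (intro zero_less_power) simp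
    obtain m where "norm ((T ^^ m) z) < \<epsilon> / R ^ Suc k"
      using small[of "\<epsilon> / R ^ Suc k"] R assms(2) by (auto intro: divide_pos_pos)
    then have "ereal (1 - \<theta> ^ Suc k) \<le> lower_density {j. norm ((T ^^ j) z) < \<epsilon>}"
      using rarely_grows_power[OF S] R assms by (intro rarely_grows_imp_lower_density_ge) auto
    moreover have "1 \<le> ereal (1 - \<theta> ^ Suc k) + ereal e" using k by (simp add: one_ereal_def)
    ultimately show "1 \<le> lower_density {j. norm ((T ^^ j) z) < \<epsilon>} + ereal e"
      by (meson add_right_mono order_trans)
  qed
  with assms(3) show False by simp
qed

section \<open>A distributionally irregular vector\<close>

text \<open>Having at least \<open>r\<close> visits means that some finite \<open>J\<close> of that
  size consists of visits: a union of finite intersections of open preimages.\<close>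

lemma open_card_visits:
  fixes f :: "nat \<Rightarrow> 'a::topological_space \<Rightarrow> 'b::topological_space"
  assumes "\<And>j. continuous_on UNIV (f j)" "open U"
  shows "open {x. r \<le> real (card ({j. f j x \<in> U} \<inter> {1..n}))}"
proof -
  have "{x. r \<le> real (card ({j. f j x \<in> U} \<inter> {1..n}))}
      = (\<Union>J\<in>{J. J \<subseteq> {1..n} \<and> r \<le> real (card J)}. \<Inter>j\<in>J. f j -` U)" (is "?L = ?R")
  proof
    show "?L \<subseteq> ?R"
    proof
      fix x assume "x \<in> ?L"
      then show "x \<in> ?R" by (intro UN_I[of "{j. f j x \<in> U} \<inter> {1..n}"]) auto
    qed
    show "?R \<subseteq> ?L"
    proof
      fix x assume "x \<in> ?R"
      then obtain J where J: "J \<subseteq> {1..n}" "r \<le> real (card J)" "\<And>j. j \<in> J \<Longrightarrow> f j x \<in> U" by auto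
      then have "card J \<le> card ({j. f j x \<in> U} \<inter> {1..n})" by (intro card_mono) auto
      then show "x \<in> ?L" using J by simp
    qed
  qed
  moreover have "open (\<Inter>j\<in>J. f j -` U)" if "J \<subseteq> {1..n}" for J
    using that assms by (intro open_INT finite_subset[OF that] ballI open_vimage) auto
  ultimately show ?thesis by (simp add: open_UN)
qed

definition often_in :: "('a::real_normed_vector \<Rightarrow> 'a) \<Rightarrow> 'a set \<Rightarrow> nat \<Rightarrow> 'a set" where
  "often_in T U k =
     {x. \<exists>n\<ge>Suc k. (1 - 1 / real (Suc k)) * real n \<le> real (card ({j. (T ^^ j) x \<in> U} \<inter> {1..n}))}"

lemma upper_density_eq_1_if_often_in:
  assumes "\<And>k. x \<in> often_in T (U k) k" "\<And>k. k \<ge> k0 \<Longrightarrow> U k \<subseteq> W"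
  shows "upper_density {j. (T ^^ j) x \<in> W} = 1"
proof (rule upper_density_eq_1I)
  fix e :: real assume "e > 0"
  then obtain k1 where k1: "1 / real (Suc k1) < e" using nat_approx_posE by blast
  show "\<exists>\<^sub>F n in sequentially. (1 - e) * real n \<le> real (card ({j. (T ^^ j) x \<in> W} \<inter> {1..n}))"
    unfolding frequently_sequentially
  proof
    fix N
    \<comment> \<open>The three bounds on \<open>k\<close> give, in turn, a window of length at
      least \<open>N\<close>, the inclusion of \<open>U k\<close> in \<open>W\<close>, and a defect
      below \<open>e\<close>.\<close>
    define k where "k = max N (max k0 k1)"
    obtain n where n: "n \<ge> Suc k"
      "(1 - 1 / real (Suc k)) * real n \<le> real (card ({j. (T ^^ j) x \<in> U k} \<inter> {1..n}))"
      using assms(1)[of k] by (auto simp: often_in_def)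
    have "1 / real (Suc k) \<le> 1 / real (Suc k1)" by (intro divide_left_mono) (auto simp: k_def)
    then have "(1 - e) * real n \<le> (1 - 1 / real (Suc k)) * real n"
      using k1 by (intro mult_right_mono) auto
    also note n(2)
    also have "real (card ({j. (T ^^ j) x \<in> U k} \<inter> {1..n}))
        \<le> real (card ({j. (T ^^ j) x \<in> W} \<inter> {1..n}))"
      using assms(2)[of k] by (intro of_nat_mono card_mono) (auto simp: k_def subset_iff)
    finally show "\<exists>n\<ge>N. (1 - e) * real n \<le> real (card ({j. (T ^^ j) x \<in> W} \<inter> {1..n}))"
      using n(1) by (intro exI[of _ n]) (auto simp: k_def)
  qed
qed

section \<open>Openness and density of the sets of frequent visits\<close>

lemma bounded_linear_funpow:
  fixes T :: "'a::real_normed_vector \<Rightarrow> 'a"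
  assumes "bounded_linear T"
  shows "bounded_linear (T ^^ n)"
proof (induction n)
  case 0
  then show ?case by (simp add: id_def bounded_linear_ident)
next
  case (Suc n)
  then show ?case using bounded_linear_compose[OF assms Suc] by (simp add: o_def)
qed

lemma open_often_in:
  assumes "bounded_linear T" "open U"
  shows "open (often_in T U k)"
proof -
  have "often_in T U k = (\<Union>n\<in>{Suc k..}.
      {x. (1 - 1 / real (Suc k)) * real n \<le> real (card ({j. (T ^^ j) x \<in> U} \<inter> {1..n}))})"
    by (auto simp: often_in_def)
  moreover have "open {x. r \<le> real (card ({j. (T ^^ j) x \<in> U} \<inter> {1..n}))}" for r n
    by (intro open_card_visits linear_continuous_on bounded_linear_funpow assms)
  ultimately show ?thesis by (simp only:) (intro open_UN ballI)
qed

lemma tendsto_imp_often_in_ball: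
  fixes T :: "'a::real_normed_vector \<Rightarrow> 'a"
  assumes "(\<lambda>n. (T ^^ n) x) \<longlonglongrightarrow> 0" "\<delta> > 0"
  shows "x \<in> often_in T (ball 0 \<delta>) k"
proof -
  obtain M where M: "\<And>n. n \<ge> M \<Longrightarrow> norm ((T ^^ n) x) < \<delta>"
    using LIMSEQ_D[OF assms] by auto
  define n where "n = Suc k * (M + 1)"
  have "{M+1..n} \<subseteq> {j. (T ^^ j) x \<in> ball 0 \<delta>} \<inter> {1..n}" using M by auto
  then have "card {M+1..n} \<le> card ({j. (T ^^ j) x \<in> ball 0 \<delta>} \<inter> {1..n})" by (intro card_mono) auto
  then have 1: "n - M \<le> card ({j. (T ^^ j) x \<in> ball 0 \<delta>} \<inter> {1..n})" by simp
  have "(1 - 1 / real (Suc k)) * real n = real n - real (M + 1)"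
    unfolding n_def of_nat_mult by (simp add: left_diff_distrib del: of_nat_Suc of_nat_add)
  also have "\<dots> \<le> real (n - M)" by simp
  also have "\<dots> \<le> real (card ({j. (T ^^ j) x \<in> ball 0 \<delta>} \<inter> {1..n}))" using 1 by (simp only: of_nat_le_iff)
  finally show ?thesis unfolding often_in_def by (auto simp: n_def intro!: exI[of _ n])
qed

lemma bounded_linear_funpow_bound:
  fixes T :: "'a::real_normed_vector \<Rightarrow> 'a"
  assumes "bounded_linear T"
  obtains C where "C \<ge> 1" "\<And>j x. norm ((T ^^ j) x) \<le> C ^ j * norm x"
proof -
  obtain K where K: "\<And>x. norm (T x) \<le> norm x * K" using bounded_linear.bounded[OF assms] by auto
  define C where "C = max 1 K"
  have C: "norm (T x) \<le> C * norm x" for x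
    using K[of x] mult_left_mono[of K C "norm x"] by (simp add: C_def mult.commute)
  have "norm ((T ^^ j) x) \<le> C ^ j * norm x" for j x
  proof (induction j)
    case (Suc j)
    have "norm ((T ^^ Suc j) x) \<le> C * norm ((T ^^ j) x)" using C by simp
    also have "\<dots> \<le> C * (C ^ j * norm x)" using Suc by (intro mult_left_mono) (simp_all add: C_def)
    finally show ?case by (simp add: mult.assoc)
  qed simp
  then show ?thesis using that[of C] by (simp add: C_def)
qed

text \<open>Where growth is not rare, a vector of bounded orbit becomes one with a mostly large orbit
  after adding a small multiple of a vector whose orbit grows by a huge factor.\<close>

lemma often_in_large_perturbation:
  fixes T :: "'a::real_normed_vector \<Rightarrow> 'a"
  assumes T: "bounded_linear T"
    and grow: "\<And>R \<theta>. R \<ge> 1 \<Longrightarrow> 0 \<le> \<theta> \<Longrightarrow> \<theta> < 1 \<Longrightarrow> \<not> rarely_grows T R \<theta>"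
    and bdd: "\<And>j. norm ((T ^^ j) x) \<le> M" and "\<delta> > 0"
  obtains w where "norm w \<le> \<delta>" "x + w \<in> often_in T (- cball 0 L) k"
proof -
  obtain C where C: "C \<ge> 1" "\<And>j x. norm ((T ^^ j) x) \<le> C ^ j * norm x"
    using bounded_linear_funpow_bound[OF T] by blast
  \<comment> \<open>The first bound delays growth by \<open>R\<close> beyond time
    \<open>Suc k\<close>, since norms grow at most by \<open>C\<close> per step; this makes the
    window long enough. The second lets a vector of norm \<delta> outgrow both \<open>L\<close> and
    the orbit bound \<open>M\<close>.\<close>
  define R where "R = max (C ^ Suc k) ((\<bar>L\<bar> + M) / \<delta>)"
  have R: "R \<ge> C ^ Suc k" "R \<ge> (\<bar>L\<bar> + M) / \<delta>" by (auto simp: R_def)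
  have "R \<ge> 1" using R(1) one_le_power[OF C(1), of "Suc k"] by linarith
  define \<theta> where "\<theta> = 1 - 1 / real (Suc k)"
  have \<theta>: "0 \<le> \<theta>" "\<theta> < 1" by (auto simp: \<theta>_def)
  obtain y n where yn: "real (card ({j. R * norm y < norm ((T ^^ j) y)} \<inter> {1..n})) > \<theta> * real n"
    using grow[OF \<open>R \<ge> 1\<close> \<theta>] unfolding rarely_grows_def by (auto simp: not_le)
  have "{j. R * norm y < norm ((T ^^ j) y)} \<inter> {1..n} \<noteq> {}"
  proof
    assume "{j. R * norm y < norm ((T ^^ j) y)} \<inter> {1..n} = {}"
    with yn have "\<theta> * real n < 0" by simp
    with \<theta> show False by (simp add: mult_less_0_iff)
  qed
  then obtain j where j: "j \<le> n" "R * norm y < norm ((T ^^ j) y)" by auto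
  have y: "y \<noteq> 0" using j bounded_linear_funpow[OF T, of j] by (auto simp: bounded_linear.linear linear_0)
  have "C ^ Suc k * norm y < C ^ j * norm y"
    using j(2) C(2)[of j y] mult_right_mono[OF R(1), of "norm y"] by simp
  then have "C ^ Suc k < C ^ j" using y by (simp only: mult_less_cancel_right) auto
  then have "Suc k < j" using C(1) by (metis not_less power_increasing)
  then have n: "n \<ge> Suc k" using j by simp
  \<comment> \<open>Rescaling \<open>y\<close> to norm \<delta> keeps its growth times; at these,
    \<open>w\<close> exceeds \<delta> * R, from which the orbit of \<open>x\<close> can take away at
    most \<open>M\<close>.\<close>
  define w where "w = (\<delta> / norm y) *\<^sub>R y"
  have "norm w \<le> \<delta>" using assms(4) by (simp add: w_def)
  moreover have "x + w \<in> often_in T (- cball 0 L) k"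
  proof -
    have "{j. R * norm y < norm ((T ^^ j) y)} \<subseteq> {j. (T ^^ j) (x + w) \<in> - cball 0 L}"
    proof clarify
      fix j assume j: "R * norm y < norm ((T ^^ j) y)" "(T ^^ j) (x + w) \<in> cball 0 L"
      interpret Tj: bounded_linear "T ^^ j" by (rule bounded_linear_funpow[OF T])
      have "\<bar>L\<bar> + M \<le> \<delta> * R" using R(2) assms(4) by (simp add: divide_le_eq mult.commute)
      also have "\<delta> * R < \<delta> * (norm ((T ^^ j) y) / norm y)"
        using j y assms(4) by (intro mult_strict_left_mono) (simp_all add: less_divide_eq)
      also have "\<dots> = norm ((T ^^ j) w)" using assms(4) by (simp add: w_def Tj.scaleR)
      also have "\<dots> = norm ((T ^^ j) (x + w) - (T ^^ j) x)" by (simp add: Tj.add)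
      also have "\<dots> \<le> norm ((T ^^ j) (x + w)) + norm ((T ^^ j) x)" by (rule norm_triangle_ineq4)
      also have "\<dots> \<le> L + M" using j bdd[of j] by simp
      finally show False by simp
    qed
    then have "card ({j. R * norm y < norm ((T ^^ j) y)} \<inter> {1..n})
        \<le> card ({j. (T ^^ j) (x + w) \<in> - cball 0 L} \<inter> {1..n})"
      by (intro card_mono) auto
    then have "\<theta> * real n \<le> real (card ({j. (T ^^ j) (x + w) \<in> - cball 0 L} \<inter> {1..n}))"
      using yn by linarith
    then show ?thesis using n unfolding often_in_def \<theta>_def by blast
  qed
  ultimately show ?thesis by (rule that)
qed

lemma distributionally_irregular_vector:
  fixes T :: "'a::banach \<Rightarrow> 'a" and X0 :: "'a set"
  assumes T: "bounded_linear T" and dense: "closure X0 = UNIV"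
    and lim: "\<And>x. x \<in> X0 \<Longrightarrow> (\<lambda>n. (T ^^ n) x) \<longlonglongrightarrow> 0"
    and grow: "\<And>R \<theta>. R \<ge> 1 \<Longrightarrow> 0 \<le> \<theta> \<Longrightarrow> \<theta> < 1 \<Longrightarrow> \<not> rarely_grows T R \<theta>"
  obtains u where "\<And>\<delta>. \<delta> > 0 \<Longrightarrow> upper_density {j. norm ((T ^^ j) u) < \<delta>} = 1"
    "\<And>L. upper_density {j. L < norm ((T ^^ j) u)} = 1"
proof -
  \<comment> \<open>The balls shrink to 0 in \<open>G\<close> and exhaust the space in
    \<open>H\<close>, so one point in all these sets serves every \<delta> and every
    \<open>L\<close>.\<close>
  define G where "G k = often_in T (ball 0 (1 / real (Suc k))) k" for k
  define H where "H k = often_in T (- cball 0 (real k)) k" for k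
  have "open (G k)" "open (H k)" for k
    unfolding G_def H_def by (auto intro!: open_often_in T)
  moreover have "closure (G k) = UNIV" for k
  proof -
    have "X0 \<subseteq> G k" unfolding G_def by (auto intro!: tendsto_imp_often_in_ball lim)
    then show ?thesis using dense closure_mono by blast
  qed
  moreover have "closure (H k) = UNIV" for k
  proof -
    have "x \<in> closure (H k)" for x
      unfolding closure_approachable
    proof safe
      fix e :: real assume e: "e > 0"
      obtain x0 where x0: "x0 \<in> X0" "dist x0 x < e/2"
        using dense e by (metis UNIV_I closure_approachable half_gt_zero)
      \<comment> \<open>The convergent orbit of \<open>x0\<close> is bounded, as the perturbation
        requires; half of \<open>e\<close> is spent on \<open>x0\<close> and half on
        \<open>w\<close>.\<close>
      have "Bseq (\<lambda>n. (T ^^ n) x0)" using lim[OF x0(1)] by (intro convergent_imp_Bseq convergentI)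
      then obtain M where "\<And>n. norm ((T ^^ n) x0) \<le> M" by (auto simp: Bseq_def)
      then obtain w where w: "norm w \<le> e/2" "x0 + w \<in> H k"
        using often_in_large_perturbation[OF T grow, of x0 M "e/2"] e unfolding H_def
        by (metis half_gt_zero)
      have "dist (x0 + w) x \<le> dist x0 x + norm w"
        by (metis add.commute dist_norm dist_triangle2 add_diff_cancel_left' dist_commute)
      then show "\<exists>y\<in>H k. dist y x < e" using w x0 by (intro bexI[of _ "x0 + w"]) auto
    qed
    then show ?thesis by blast
  qed
  ultimately have "euclidean closure_of (\<Inter> (range G \<union> range H)) = topspace euclidean"
    by (intro Baire_category) (auto simp: completely_metrizable_space_euclidean)
  then have "\<Inter> (range G \<union> range H) \<noteq> {}" by (metis closure_of_empty empty_not_UNIV topspace_euclidean)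
  then obtain u where u: "\<And>k. u \<in> G k" "\<And>k. u \<in> H k" by blast
  have 1: "upper_density {j. norm ((T ^^ j) u) < \<delta>} = 1" if d: "\<delta> > 0" for \<delta>
  proof -
    obtain k0 where k0: "1 / real (Suc k0) < \<delta>" using d nat_approx_posE by blast
    have "ball (0::'a) (1 / real (Suc k)) \<subseteq> ball 0 \<delta>" if "k \<ge> k0" for k
    proof -
      have "1 / real (Suc k) \<le> 1 / real (Suc k0)" using that by (intro divide_left_mono) auto
      with k0 show ?thesis by (intro subset_ball) simp
    qed
    then have "upper_density {j. (T ^^ j) u \<in> ball 0 \<delta>} = 1"
      using u(1)[unfolded G_def] by (intro upper_density_eq_1_if_often_in[of u T _ k0])
    then show ?thesis by simp
  qed
  have 2: "upper_density {j. L < norm ((T ^^ j) u)} = 1" for L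
  proof -
    obtain k0 where k0: "L \<le> real k0" using real_arch_simple by blast
    have "upper_density {j. (T ^^ j) u \<in> - cball 0 L} = 1"
      using u(2)[unfolded H_def] k0 by (intro upper_density_eq_1_if_often_in[of u T _ k0]) auto
    then show ?thesis by (simp add: not_le)
  qed
  from 1 2 show ?thesis by (rule that)
qed

section \<open>The four notions of chaos\<close>

lemma close_times_linear:
  assumes "bounded_linear T"
  shows "close_times T x y \<delta> = {j. norm ((T ^^ j) (x - y)) < \<delta>}"
  unfolding close_times_def
  by (simp add: bounded_linear.linear[OF bounded_linear_funpow[OF assms]] linear_diff)

text \<open>Distinct points of the line through \<open>u\<close> differ by a nonzero multiple of
  \<open>u\<close>, which merely rescales \<delta>. Hence the upper density is 1 and the lower
  density 0 at every \<delta> > 0, and \<epsilon> = 1 serves all pairs at once.\<close>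

lemma chaotic_if_distributionally_irregular_vector:
  fixes T :: "'a::real_normed_vector \<Rightarrow> 'a"
  assumes T: "bounded_linear T"
    and u1: "\<And>\<delta>. \<delta> > 0 \<Longrightarrow> upper_density {j. norm ((T ^^ j) u) < \<delta>} = 1"
    and u2: "\<And>L. upper_density {j. L < norm ((T ^^ j) u)} = 1"
  shows "dist_chaotic_1 T" "dist_chaotic_2 T" "dist_chaotic_2_half T"
    "reiteratively_dist_chaotic_2 T"
proof -
  define \<Gamma> where "\<Gamma> = range (\<lambda>t::real. t *\<^sub>R u)"
  have "u \<noteq> 0"
  proof
    assume "u = 0"
    then have "{j. 0 < norm ((T ^^ j) u)} = {}"
      using bounded_linear_funpow[OF T] by (auto simp: bounded_linear.linear linear_0)
    then show False using upper_density_pos_imp_nonempty[of "{j. 0 < norm ((T ^^ j) u)}"] u2[of 0] by simp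
  qed
  then have "inj (\<lambda>t::real. t *\<^sub>R u)" by (auto simp: inj_def)
  then have unc: "uncountable \<Gamma>"
    unfolding \<Gamma>_def using uncountable_UNIV_real countable_image_inj_on by blast
  have *: "F_upper T x y \<delta> = 1 \<and> F_lower T x y \<delta> = 0"
    if xy: "x \<in> \<Gamma>" "y \<in> \<Gamma>" "x \<noteq> y" and d: "\<delta> > 0" for x y \<delta>
  proof -
    obtain s t where "x = s *\<^sub>R u" "y = t *\<^sub>R u" using xy by (auto simp: \<Gamma>_def)
    then have r: "x - y = (s - t) *\<^sub>R u" "\<bar>s - t\<bar> > 0" using xy by (auto simp: scaleR_diff_left)
    have "norm ((T ^^ j) (x - y)) = \<bar>s - t\<bar> * norm ((T ^^ j) u)" for j
      unfolding r by (simp add: linear_scale bounded_linear.linear[OF bounded_linear_funpow[OF T]])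
    then have ct: "close_times T x y \<delta> = {j. norm ((T ^^ j) u) < \<delta> / \<bar>s - t\<bar>}"
      using r(2) by (simp add: close_times_linear[OF T] less_divide_eq mult.commute)
    have "lower_density {j. norm ((T ^^ j) u) < \<delta> / \<bar>s - t\<bar>} = 0"
      by (rule lower_density_eq_0_if_disjoint[OF u2[of "\<delta> / \<bar>s - t\<bar>"]]) auto
    then show ?thesis unfolding F_upper_def F_lower_def ct using u1 d r(2) by simp
  qed
  then have B: "BF_upper T x y \<delta> = 1" if "x \<in> \<Gamma>" "y \<in> \<Gamma>" "x \<noteq> y" "\<delta> > 0" for x y \<delta>
    using that unfolding BF_upper_def F_upper_def
    by (intro upper_Banach_density_eq_1_if_upper_density_eq_1) auto
  show "dist_chaotic_1 T"
    unfolding dist_chaotic_1_def dist_chaotic_pair_1_def pairwise_def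
    using unc * by (intro exI[of _ \<Gamma>]) (auto intro!: exI[of _ "1::real"])
  show "dist_chaotic_2 T"
    unfolding dist_chaotic_2_def dist_chaotic_pair_2_def pairwise_def
    using unc * by (intro exI[of _ \<Gamma>]) (auto intro!: exI[of _ "1::real"])
  show "dist_chaotic_2_half T"
    unfolding dist_chaotic_2_half_def dist_chaotic_pair_2_half_def pairwise_def
    \<comment> \<open>The value 1/2 serves as \<open>c\<close>, between the densities 0 and 1, and
      as \<open>r\<close>.\<close>
    using unc * by (intro exI[of _ \<Gamma>]) (auto intro!: exI[of _ "1/2::real"] simp: zero_ereal_def one_ereal_def)
  show "reiteratively_dist_chaotic_2 T"
    unfolding reiteratively_dist_chaotic_2_def pairwise_def
    using unc * B by (intro exI[of _ \<Gamma>]) (auto intro!: exI[of _ "1::real"])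
qed

section \<open>From each notion of chaos to a pair that excludes rare growth\<close>

lemma uncountable_pairwiseE:
  assumes "uncountable \<Gamma>" "pairwise P \<Gamma>"
  obtains x y where "P x y"
proof -
  have "infinite \<Gamma>" using assms(1) countable_finite by blast
  then obtain x where x: "x \<in> \<Gamma>" by fastforce
  have "infinite (\<Gamma> - {x})" using \<open>infinite \<Gamma>\<close> by simp
  then have "\<Gamma> - {x} \<noteq> {}" by (metis finite.emptyI)
  then obtain y where "y \<in> \<Gamma> - {x}" by blast
  with x assms(2) that show ?thesis by (auto simp: pairwise_def)
qed

text \<open>A common weakening of all four kinds of pairs. Nonempty sets of close times replace the
  density conditions, since one close time at each scale suffices to exclude rare growth.\<close>

definition semi_chaotic_pair :: "('a::real_normed_vector \<Rightarrow> 'a) \<Rightarrow> 'a \<Rightarrow> 'a \<Rightarrow> bool" where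
  "semi_chaotic_pair T x y \<longleftrightarrow>
     (\<forall>\<delta>>0. close_times T x y \<delta> \<noteq> {}) \<and> (\<exists>\<epsilon>>0. F_lower T x y \<epsilon> < 1)"

lemma F_upper_pos_imp_nonempty: "0 < F_upper T x y \<delta> \<Longrightarrow> close_times T x y \<delta> \<noteq> {}"
  unfolding F_upper_def by (rule upper_density_pos_imp_nonempty)

lemma chaotic_imp_semi_chaotic_pair:
  assumes "dist_chaotic_1 T \<or> dist_chaotic_2 T \<or> dist_chaotic_2_half T \<or> reiteratively_dist_chaotic_2 T"
  shows "\<exists>x y. semi_chaotic_pair T x y"
  using assms
proof (elim disjE)
  assume "dist_chaotic_1 T"
  then obtain x y where "dist_chaotic_pair_1 T x y"
    unfolding dist_chaotic_1_def by (auto elim: uncountable_pairwiseE)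
  then have "semi_chaotic_pair T x y"
    unfolding dist_chaotic_pair_1_def semi_chaotic_pair_def
    using F_upper_pos_imp_nonempty[of T x y] by auto
  then show ?thesis by blast
next
  assume "dist_chaotic_2 T"
  then obtain x y where "dist_chaotic_pair_2 T x y"
    unfolding dist_chaotic_2_def by (auto elim: uncountable_pairwiseE)
  then have "semi_chaotic_pair T x y"
    unfolding dist_chaotic_pair_2_def semi_chaotic_pair_def
    using F_upper_pos_imp_nonempty[of T x y] by auto
  then show ?thesis by blast
next
  assume "dist_chaotic_2_half T"
  then obtain x y where "dist_chaotic_pair_2_half T x y"
    unfolding dist_chaotic_2_half_def by (auto elim: uncountable_pairwiseE)
  then obtain c r where cr: "c > 0" "r > 0"
    "\<And>\<delta>. 0 < \<delta> \<Longrightarrow> \<delta> < r \<Longrightarrow> F_lower T x y \<delta> < ereal c \<and> ereal c < F_upper T x y \<delta>"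
    unfolding dist_chaotic_pair_2_half_def by blast
  \<comment> \<open>Type 2 1/2 speaks only of radii below \<open>r\<close>; larger radii follow
    because close times increase with \<delta>.\<close>
  have "close_times T x y \<delta> \<noteq> {}" if "\<delta> > 0" for \<delta>
  proof -
    have "0 < ereal c" using cr(1) by simp
    also have "ereal c < F_upper T x y (min \<delta> (r/2))" using cr(2,3) that by simp
    finally have "close_times T x y (min \<delta> (r/2)) \<noteq> {}" by (rule F_upper_pos_imp_nonempty)
    then show ?thesis by (auto simp: close_times_def)
  qed
  moreover have "F_lower T x y (r/2) < 1"
    using cr(2) cr(3)[of "r/2"] upper_density_le_1[of "close_times T x y (r/2)"]
    by (auto simp: F_upper_def)
  ultimately have "semi_chaotic_pair T x y"
    unfolding semi_chaotic_pair_def using cr(2) by (meson half_gt_zero)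
  then show ?thesis by blast
next
  assume "reiteratively_dist_chaotic_2 T"
  then obtain x y \<epsilon> where "\<epsilon> > 0" "\<forall>\<delta>>0. BF_upper T x y \<delta> = 1" "F_lower T x y \<epsilon> < 1"
    unfolding reiteratively_dist_chaotic_2_def by (auto elim: uncountable_pairwiseE)
  then have "semi_chaotic_pair T x y"
    unfolding semi_chaotic_pair_def BF_upper_def
    by (metis upper_Banach_density_empty zero_neq_one)
  then show ?thesis by blast
qed

theorem theorem2p9:
  fixes T :: "'a::banach \<Rightarrow> 'a" and X0 :: "'a set"
  assumes "bounded_linear T"
    and "closure X0 = UNIV"
    and "\<And>x. x \<in> X0 \<Longrightarrow> (\<lambda>n. (T ^^ n) x) \<longlonglongrightarrow> 0"
  shows "(dist_chaotic_1 T \<longleftrightarrow> dist_chaotic_2 T) \<and>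
         (dist_chaotic_2 T \<longleftrightarrow> dist_chaotic_2_half T) \<and>
         (dist_chaotic_2_half T \<longleftrightarrow> reiteratively_dist_chaotic_2 T)"
proof -
  \<comment> \<open>Any one of the four notions yields the vector \<open>u\<close> and thereby all
    four, which contains every equivalence.\<close>
  have "dist_chaotic_1 T \<and> dist_chaotic_2 T \<and> dist_chaotic_2_half T \<and> reiteratively_dist_chaotic_2 T"
    if chaos: "dist_chaotic_1 T \<or> dist_chaotic_2 T \<or> dist_chaotic_2_half T \<or> reiteratively_dist_chaotic_2 T"
  proof -
    obtain x y where "semi_chaotic_pair T x y" using chaotic_imp_semi_chaotic_pair[OF chaos] by blast
    then obtain \<epsilon> where "\<And>\<delta>. \<delta> > 0 \<Longrightarrow> \<exists>m. norm ((T ^^ m) (x - y)) < \<delta>"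
      "\<epsilon> > 0" "lower_density {j. norm ((T ^^ j) (x - y)) < \<epsilon>} < 1"
      unfolding semi_chaotic_pair_def F_lower_def close_times_linear[OF assms(1)] by blast
    then have "\<not> rarely_grows T R \<theta>" if "R \<ge> 1" "0 \<le> \<theta>" "\<theta> < 1" for R \<theta>
      using that by (rule not_rarely_grows)
    then obtain u where "\<And>\<delta>. \<delta> > 0 \<Longrightarrow> upper_density {j. norm ((T ^^ j) u) < \<delta>} = 1"
      "\<And>L. upper_density {j. L < norm ((T ^^ j) u)} = 1"
      using distributionally_irregular_vector[OF assms] by blast
    then show ?thesis
      using chaotic_if_distributionally_irregular_vector[OF assms(1)] by blast
  qed
  then show ?thesis by blast
qed

end
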